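(* Let $(G,A)$ be a simple edge-weighted graph on vertices $v_1,\dots,v_n$, and let $(G',A')$ be the result of collapsing operations that remove the vertices $v_{r+1},\dots,v_n$ (each by a star-clique operation applied to a graph without multiple edges, with multiple edges collapsed), so that $G'$ has vertices $v_1,\dots,v_r$. Define $\phi:S_G\to S_{G'}$ by $\phi(g_1,\dots,g_n)=(g_1,\dots,g_r)$ and let $K=\ker\phi$. Let $i<r$ and $F\in\mathcal{F}_i$. Then: (1) $\phi(\mathcal{F}_i)=\mathcal{F}'_i$; (2) $L(F)=L(\phi(F))$; (3) $F$ is a minimal element of $\mathcal{F}_i$ if and only if $\phi(F)$ is a minimal element of $\mathcal{F}'_i$; (4) if $\mathcal{B}'$ is a flow-up class basis of $S_{G'}$, $\mathcal{K}$ is a flow-up class basis of $K$, and $\mathcal{B}$ consists of one pre-image under $\phi$ of each element of $\mathcal{B}'$, then $\mathcal{B}\cup\mathcal{K}$ is a flow-up class basis of $S_G$; (5) $S_G\cong S_{G'}\oplus K$ as $\mathbb{Z}$-modules.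
   Context: An edge-weighted graph $(G,A)$ is a finite loopless graph (multiple edges allowed unless "simple" is stated) with a weight function $A$ from its edges to positive integers. A spline on $(G,A)$ with vertices $v_1,\dots,v_n$ is $(g_1,\dots,g_n)\in\mathbb{Z}^n$ with $g_k\equiv g_l\pmod{A(e)}$ for every edge $e$ joining $v_k$ and $v_l$; $S_G$ is the $\mathbb{Z}$-module of splines. Star-clique on a vertex $v$ (of a graph without multiple edges) with neighbours $w_1,\dots,w_d$ and edge $vw_k$ of weight $a_k$: delete $v$ and its incident edges and, for each pair $s<t$, add a new edge between $w_s$ and $w_t$ of weight $\gcd(a_s,a_t)$ (possibly creating multiple edges). Edge collapse: replace edges $e_1,\dots,e_m$ ($m\ge2$) joining the same pair of vertices, of weights $a_1,\dots,a_m$, by one edge of weight $\operatorname{lcm}(a_1,\dots,a_m)$. Flow-up classes: for $0\le i<n$, $\mathcal{F}_i\subseteq S_G$ is the set of splines with $g_1=\cdots=g_i=0$, $g_{i+1}\ne0$; $\mathcal{F}_n=\{0\}$; $\mathcal{F}'_i\subseteq S_{G'}$ ($0\le i\le r$) are defined likewise for $S_{G'}$. For $F\in\mathcal{F}_i$ the leading term is $L(F)=g_{i+1}$. A minimal element of $\mathcal{F}_i$ is $B\in\mathcal{F}_i$ with $L(B)>0$ and $L(B)\le|L(F)|$ for all $F\in\mathcal{F}_i$ (similarly for $\mathcal{F}'_i$). A flow-up class basis of $S_G$ (resp. $S_{G'}$) is a $\mathbb{Z}$-basis consisting of one minimal element of each $\mathcal{F}_i$, $0\le i<n$ (resp. $\mathcal{F}'_i$,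 $0\le i<r$). Since $K$ consists of the splines with first $r$ coordinates zero, $K=\mathcal{F}_r\cup\dots\cup\mathcal{F}_n$, and a flow-up class basis of $K$ is a $\mathbb{Z}$-basis of $K$ consisting of one minimal element of each $\mathcal{F}_i$, $r\le i<n$. *)

theory Defs
  imports
    Complex_Main
    "HOL-Library.Multiset"
    "HOL-Library.Function_Algebras"
    "HOL-Library.Product_Plus"
    "HOL-Number_Theory.Cong"
begin

section \<open>Edge-weighted graphs\<close>

text \<open>
  The vertex \<open>v\<^sub>k\<close> is represented by the number \<open>k\<close>. Edges have no names: an edge is its pair of
  endpoints together with its weight, and parallel edges (possibly of equal weight) are
  accounted for by collecting the edges in a multiset.
\<close>

record wgraph =
  verts :: "nat set"
  edges :: "(nat set \<times> int) multiset"

definition edge_weighted_graph :: "wgraph \<Rightarrow> bool" where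
  "edge_weighted_graph G \<longleftrightarrow>
     finite (verts G) \<and> (\<forall>(e, a) \<in># edges G. e \<subseteq> verts G \<and> card e = 2 \<and> a > 0)"

text \<open>Loops are already excluded above, so simplicity only has to exclude multiple edges.\<close>

definition simple :: "wgraph \<Rightarrow> bool" where
  "simple G \<longleftrightarrow> (\<forall>e. count (image_mset fst (edges G)) e \<le> 1)"

section \<open>Collapsing operations\<close>

definition neighbours :: "wgraph \<Rightarrow> nat \<Rightarrow> nat set" where
  "neighbours G v = {w. \<exists>a. ({v, w}, a) \<in># edges G}"

text \<open>Only meaningful if there is exactly one edge joining the two vertices.\<close>

definition weight :: "wgraph \<Rightarrow> nat \<Rightarrow> nat \<Rightarrow> int" where
  "weight G v w = (THE a. ({v, w}, a) \<in># edges G)"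

text \<open>
  The neighbours \<open>w\<^sub>1, \<dots>, w\<^sub>d\<close> of \<open>v\<close> are listed in increasing order, so that the pairs of
  indices \<open>s < t\<close> correspond to the pairs of neighbours \<open>x < y\<close>.
\<close>

definition star_clique :: "wgraph \<Rightarrow> nat \<Rightarrow> wgraph" where
  "star_clique G v =
     \<lparr> verts = verts G - {v},
       edges = {# e \<in># edges G. v \<notin> fst e #}
         + image_mset (\<lambda>(x, y). ({x, y}, gcd (weight G v x) (weight G v y)))
             (mset_set {(x, y). x \<in> neighbours G v \<and> y \<in> neighbours G v \<and> x < y}) \<rparr>"

text \<open>
  \<open>W\<close> is the multiset of weights \<open>a\<^sub>1, \<dots>, a\<^sub>m\<close> of the edges to be collapsed, all of which have
  the endpoints \<open>e\<close>; they need not be all the edges joining these endpoints.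
\<close>

definition edge_collapse :: "wgraph \<Rightarrow> wgraph \<Rightarrow> bool" where
  "edge_collapse G H \<longleftrightarrow>
     (\<exists>e W. size W \<ge> 2 \<and> image_mset (Pair e) W \<subseteq># edges G \<and>
        verts H = verts G \<and>
        edges H = edges G - image_mset (Pair e) W + {# (e, Lcm (set_mset W)) #})"

definition remove_vertex :: "wgraph \<Rightarrow> wgraph \<Rightarrow> bool" where
  "remove_vertex G H \<longleftrightarrow>
     simple G \<and> (\<exists>v \<in> verts G. edge_collapse\<^sup>*\<^sup>* (star_clique G v) H) \<and> simple H"

text \<open>Vertices may be removed in any order; which ones are removed is read off from \<^term>\<open>verts H\<close>.\<close>

definition collapses_to :: "wgraph \<Rightarrow> wgraph \<Rightarrow> bool" where
  "collapses_to G H \<longleftrightarrow> remove_vertex\<^sup>*\<^sup>* G H"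

section \<open>Splines\<close>

text \<open>
  An element of \<open>\<int>\<^sup>n\<close> is a function that vanishes outside \<open>{1..n}\<close>. Addition and zero are the
  pointwise ones of \<^theory>\<open>HOL-Library.Function_Algebras\<close>.
\<close>

definition zscale :: "int \<Rightarrow> (nat \<Rightarrow> int) \<Rightarrow> nat \<Rightarrow> int" where
  "zscale c g = (\<lambda>k. c * g k)"

global_interpretation zmod: module zscale
  defines zspan = zmod.span and zdependent = zmod.dependent and zsubspace = zmod.subspace
    and zrepresentation = zmod.representation
  by unfold_locales (auto simp: zscale_def fun_eq_iff algebra_simps)

definition splines :: "wgraph \<Rightarrow> (nat \<Rightarrow> int) set" where
  "splines G =
     {g. (\<forall>k. k \<notin> verts G \<longrightarrow> g k = 0) \<and>
         (\<forall>k l a. ({k, l}, a) \<in># edges G \<longrightarrow> [g k = g l] (mod a))}"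

lemma zsubspace_splines: "zsubspace (splines G)"
  unfolding zmod.subspace_def
proof (intro conjI ballI allI)
  show "0 \<in> splines G"
    by (auto simp: splines_def)
  fix x assume x: "x \<in> splines G"
  show "zscale c x \<in> splines G" for c
    using x unfolding splines_def zscale_def by (auto intro: cong_scalar_left)
  fix y assume "y \<in> splines G"
  then show "x + y \<in> splines G"
    using x unfolding splines_def by (auto intro: cong_add)
qed

definition z_basis :: "(nat \<Rightarrow> int) set \<Rightarrow> (nat \<Rightarrow> int) set \<Rightarrow> bool" where
  "z_basis B M \<longleftrightarrow> B \<subseteq> M \<and> \<not> zdependent B \<and> zspan B = M"

text \<open>
  Isomorphism of modules carried by subsets \<open>A\<close>, \<open>B\<close> of ambient types, whose scalar
  multiplications are \<open>s\<close> and \<open>t\<close>.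
\<close>

definition module_iso_on ::
    "(int \<Rightarrow> 'a \<Rightarrow> 'a) \<Rightarrow> (int \<Rightarrow> 'b \<Rightarrow> 'b) \<Rightarrow> 'a::ab_group_add set \<Rightarrow> 'b::ab_group_add set \<Rightarrow> bool" where
  "module_iso_on s t A B \<longleftrightarrow>
     (\<exists>f. bij_betw f A B \<and>
        (\<forall>x\<in>A. \<forall>y\<in>A. f (x + y) = f x + f y) \<and>
        (\<forall>c. \<forall>x\<in>A. f (s c x) = t c (f x)))"

text \<open>The direct sum of \<open>M\<close> and \<open>N\<close> is \<open>M \<times> N\<close> with componentwise operations.\<close>

definition zscale_sum ::
    "int \<Rightarrow> (nat \<Rightarrow> int) \<times> (nat \<Rightarrow> int) \<Rightarrow> (nat \<Rightarrow> int) \<times> (nat \<Rightarrow> int)" where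
  "zscale_sum c = map_prod (zscale c) (zscale c)"

section \<open>Flow-up classes\<close>

text \<open>The vertex set is assumed to be \<open>{1..n}\<close>, so \<open>n\<close> is its cardinality.\<close>

definition flow_up :: "wgraph \<Rightarrow> nat \<Rightarrow> (nat \<Rightarrow> int) set" where
  "flow_up G i =
     (if i < card (verts G) then {g \<in> splines G. (\<forall>k\<in>{1..i}. g k = 0) \<and> g (Suc i) \<noteq> 0}
      else if i = card (verts G) then {0}
      else {})"

text \<open>The index \<open>i\<close> with \<open>F \<in> \<F>\<^sub>i\<close> is determined by \<open>F\<close>, see the lemma below.\<close>

definition leading_term :: "wgraph \<Rightarrow> (nat \<Rightarrow> int) \<Rightarrow> int" where
  "leading_term G F = F (Suc (THE i. F \<in> flow_up G i))"

lemma leading_term_eq: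
  assumes "F \<in> flow_up G i"
  shows "leading_term G F = F (Suc i)"
proof -
  have less: "\<not> j < k" if "F \<in> flow_up G j" "F \<in> flow_up G k" for j k
  proof
    assume "j < k"
    with that have j: "F (Suc j) \<noteq> 0"
      by (auto simp: flow_up_def split: if_splits)
    from that(2) \<open>j < k\<close> have "F (Suc j) = 0"
      by (auto simp: flow_up_def split: if_splits)
    with j show False ..
  qed
  have "(THE i. F \<in> flow_up G i) = i"
    using assms less by (intro the_equality) (auto simp: not_less intro: antisym)
  then show ?thesis
    by (simp add: leading_term_def)
qed

definition minimal_element :: "wgraph \<Rightarrow> nat \<Rightarrow> (nat \<Rightarrow> int) \<Rightarrow> bool" where
  "minimal_element G i B \<longleftrightarrow>
     B \<in> flow_up G i \<and> leading_term G B > 0 \<and>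
     (\<forall>F \<in> flow_up G i. leading_term G B \<le> \<bar>leading_term G F\<bar>)"

definition flow_up_class_basis ::
    "wgraph \<Rightarrow> nat set \<Rightarrow> (nat \<Rightarrow> int) set \<Rightarrow> (nat \<Rightarrow> int) set \<Rightarrow> bool" where
  "flow_up_class_basis G I M B \<longleftrightarrow>
     z_basis B M \<and> (\<exists>b. (\<forall>i\<in>I. minimal_element G i (b i)) \<and> B = b ` I)"

section \<open>The restriction map\<close>

definition restr :: "nat \<Rightarrow> (nat \<Rightarrow> int) \<Rightarrow> nat \<Rightarrow> int" where
  "restr r g = (\<lambda>k. if k \<in> {1..r} then g k else 0)"

definition ker_restr :: "wgraph \<Rightarrow> nat \<Rightarrow> (nat \<Rightarrow> int) set" where
  "ker_restr G r = {g \<in> splines G. restr r g = 0}"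

end

theory Submission
  imports Defs
begin

text \<open>
  A spline on the star-clique of \<open>v\<close> extends to \<open>v\<close>: the value there has to solve the congruences
  imposed by the neighbours, and the clique edges say exactly that these are pairwise compatible
  modulo the gcds of their moduli. Edge collapses do not change the splines. Hence restriction maps
  \<open>S\<^sub>G\<close> onto \<open>S\<^sub>G\<^sub>'\<close>, and since \<open>i < r\<close> it preserves the entries that define flow-up classes, leading
  terms and minimality. Bases of the image and of the kernel combine to a basis of \<open>S\<^sub>G\<close>, and the
  sequence splits because \<open>S\<^sub>G\<^sub>'\<close>, a submodule of \<open>\<int>\<^sup>r\<close>, is projective.
\<close>

section \<open>A Chinese remainder theorem for non-coprime moduli\<close>

text \<open>Every solution of the first congruence has the form \<open>x + a * t\<close>, so the
  second one asks for \<open>a * t\<close> congruent to \<open>y - x\<close> modulo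
  \<open>b\<close>. By Bezout this is solvable because \<open>gcd a b\<close> divides
  \<open>y - x\<close>.\<close>

lemma cong_common_solution:
  fixes a b x y :: int
  assumes "[x = y] (mod gcd a b)"
  shows "\<exists>z. [z = x] (mod a) \<and> [z = y] (mod b)"
proof -
  from assms have "gcd a b dvd y - x"
    by (metis cong_iff_dvd_diff cong_sym)
  then obtain t where t: "[a * t = y - x] (mod b)"
    using cong_solve_dvd_int by blast
  have "[x + a * t = x] (mod a)"
    by (simp add: cong_iff_dvd_diff)
  moreover have "[x + a * t = y] (mod b)"
    using t by (simp add: cong_iff_dvd_diff algebra_simps)
  ultimately show ?thesis
    by blast
qed

text \<open>By distributivity of the divisibility lattice, the gcd with an lcm is the lcm of the
  gcds.\<close>

lemma gcd_Lcm_dvd: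
  fixes a :: "'a \<Rightarrow> int"
  assumes "finite I" and "\<And>i. i \<in> I \<Longrightarrow> gcd b (a i) dvd d"
  shows "gcd b (Lcm (a ` I)) dvd d"
  using assms by (induction I) (simp_all add: gcd_lcm_distrib)

text \<open>A solution \<open>y\<close> for \<open>I\<close> stands for all its congruences at once,
  as one class modulo their lcm. A new congruence is then merged by the case of two moduli.\<close>

lemma cong_simultaneous_solution:
  fixes a x :: "'a \<Rightarrow> int"
  assumes "finite I"
    and "\<And>i j. i \<in> I \<Longrightarrow> j \<in> I \<Longrightarrow> [x i = x j] (mod gcd (a i) (a j))"
  shows "\<exists>z. \<forall>i\<in>I. [z = x i] (mod a i)"
  using assms
proof (induction I)
  case empty
  then show ?case by simp
next
  case (insert j I)
  then obtain y where y: "[y = x i] (mod a i)" if "i \<in> I" for i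
    by auto
  have "gcd (a j) (a i) dvd x j - y" if "i \<in> I" for i
  proof -
    have "[x j = x i] (mod gcd (a j) (a i))"
      using insert.prems that by simp
    moreover have "[x i = y] (mod gcd (a j) (a i))"
      using y[OF that] cong_dvd_modulus cong_sym gcd_dvd2 by blast
    ultimately show ?thesis
      by (meson cong_iff_dvd_diff cong_trans)
  qed
  \<comment> \<open>Pairwise compatibility with the old moduli is lifted to compatibility with their
    lcm.\<close>
  then have "[x j = y] (mod gcd (a j) (Lcm (a ` I)))"
    unfolding cong_iff_dvd_diff by (rule gcd_Lcm_dvd[OF insert.hyps(1)])
  then obtain z where z: "[z = x j] (mod a j)" "[z = y] (mod Lcm (a ` I))"
    using cong_common_solution by blast
  have "[z = x i] (mod a i)" if "i \<in> I" for i
    using that z(2) y[OF that] by (meson cong_dvd_modulus cong_trans dvd_Lcm imageI)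
  with z(1) show ?case
    by auto
qed

section \<open>Collapsing operations and splines\<close>

lemma edge_weighted_graph_edgeD:
  assumes "edge_weighted_graph G" and "({k, l}, a) \<in># edges G"
  shows "k \<noteq> l" and "k \<in> verts G" and "l \<in> verts G" and "a > 0"
  using assms unfolding edge_weighted_graph_def by (force simp: card_insert_if split: if_splits)+

lemma simple_edge_unique:
  assumes "simple G" and "(e, a) \<in># edges G" and "(e, b) \<in># edges G"
  shows "a = b"
proof (rule ccontr)
  assume "a \<noteq> b"
  obtain M where M: "edges G = add_mset (e, a) M"
    using assms(2) by (meson multi_member_split)
  with assms(3) \<open>a \<noteq> b\<close> obtain N where "M = add_mset (e, b) N"
    by (auto dest: multi_member_split)
  with M have "count (image_mset fst (edges G)) e \<ge> 2"
    by simp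
  with assms(1) show False
    unfolding simple_def by (metis not_less_eq_eq numeral_2_eq_2 One_nat_def)
qed

lemma weight_eq:
  assumes "simple G" and "({v, w}, a) \<in># edges G"
  shows "weight G v w = a"
  unfolding weight_def using assms simple_edge_unique by blast

text \<open>Trades the truncated multiset difference for a sum, so that the unchanged edges
  \<open>R\<close> are common to both graphs. Nonemptiness of \<open>W\<close> later provides an
  actual edge with endpoints \<open>e\<close>.\<close>

lemma edge_collapse_decompose:
  assumes "edge_collapse G H"
  obtains R e W where "edges G = R + image_mset (Pair e) W" "W \<noteq> {#}"
    "verts H = verts G" "edges H = R + {#(e, Lcm (set_mset W))#}"
proof -
  from assms obtain e W where "size W \<ge> 2" "image_mset (Pair e) W \<subseteq># edges G"
      "verts H = verts G"
      "edges H = edges G - image_mset (Pair e) W + {#(e, Lcm (set_mset W))#}"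
    unfolding edge_collapse_def by blast
  then show ?thesis
    by (intro that[of "edges G - image_mset (Pair e) W" e W]) auto
qed

lemma edge_weighted_graph_edge_collapse:
  assumes "edge_weighted_graph G" and "edge_collapse G H"
  shows "edge_weighted_graph H"
proof -
  obtain R e W where *: "edges G = R + image_mset (Pair e) W" "W \<noteq> {#}"
      "verts H = verts G" "edges H = R + {#(e, Lcm (set_mset W))#}"
    using assms(2) by (rule edge_collapse_decompose)
  have "\<forall>a\<in>#W. a > 0"
    using assms(1) *(1) by (auto simp: edge_weighted_graph_def)
  \<comment> \<open>The lcm of a finite set of integers vanishes only if the set contains
    zero.\<close>
  then have "Lcm (set_mset W) \<noteq> 0"
    by (auto simp: Lcm_0_iff)
  moreover have "Lcm (set_mset W) \<ge> 0"
    by (rule Lcm_int_greater_eq_0)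
  ultimately have "Lcm (set_mset W) > 0"
    by linarith
  moreover have "e \<subseteq> verts G" "card e = 2"
  proof -
    obtain a where "a \<in># W"
      using *(2) by blast
    then have "(e, a) \<in># edges G"
      by (simp add: *(1))
    then show "e \<subseteq> verts G" "card e = 2"
      using assms(1) by (auto simp: edge_weighted_graph_def)
  qed
  ultimately show ?thesis
    using assms(1) * by (auto simp: edge_weighted_graph_def)
qed

text \<open>A congruence modulo an lcm is equivalent to the congruences modulo all the
  weights.\<close>

lemma splines_edge_collapse:
  assumes "edge_collapse G H"
  shows "splines H = splines G"
proof -
  obtain R e W where *: "edges G = R + image_mset (Pair e) W" "W \<noteq> {#}"
      "verts H = verts G" "edges H = R + {#(e, Lcm (set_mset W))#}"
    using assms by (rule edge_collapse_decompose)
  have "[x = y] (mod Lcm (set_mset W)) \<longleftrightarrow> (\<forall>a\<in>#W. [x = y] (mod a))" for x y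
    by (simp add: cong_iff_dvd_diff Lcm_dvd_iff)
  then show ?thesis
    using * by (auto simp: splines_def)
qed

text \<open>Arbitrary sets are allowed because vertices may be removed in any order, so the
  intermediate vertex sets need not be initial segments as in \<open>restr\<close>.\<close>

definition restrict_to :: "nat set \<Rightarrow> (nat \<Rightarrow> int) \<Rightarrow> nat \<Rightarrow> int" where
  "restrict_to S g = (\<lambda>k. if k \<in> S then g k else 0)"

lemma restrict_to_splines_id:
  assumes "g \<in> splines G"
  shows "restrict_to (verts G) g = g"
  using assms by (auto simp: restrict_to_def splines_def)

lemma restrict_to_restrict_to:
  assumes "S \<subseteq> T"
  shows "restrict_to S (restrict_to T g) = restrict_to S g"
  using assms by (auto simp: restrict_to_def fun_eq_iff)

section \<open>Star-clique operations\<close>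

lemma neighbours_subset:
  assumes "edge_weighted_graph G"
  shows "neighbours G v \<subseteq> verts G - {v}"
  using edge_weighted_graph_edgeD[OF assms] unfolding neighbours_def by blast

lemma finite_neighbours:
  assumes "edge_weighted_graph G"
  shows "finite (neighbours G v)"
  using finite_subset[OF neighbours_subset[OF assms]] assms
  by (auto simp: edge_weighted_graph_def)

lemma edge_weight:
  assumes "simple G" and "w \<in> neighbours G v"
  shows "({v, w}, weight G v w) \<in># edges G"
  using assms weight_eq unfolding neighbours_def by fastforce

lemma edges_star_clique_iff:
  assumes "edge_weighted_graph G"
  shows "(e, a) \<in># edges (star_clique G v) \<longleftrightarrow>
    (e, a) \<in># edges G \<and> v \<notin> e \<or>
    (\<exists>x\<in>neighbours G v. \<exists>y\<in>neighbours G v.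
       x < y \<and> e = {x, y} \<and> a = gcd (weight G v x) (weight G v y))"
proof -
  \<comment> \<open>On an infinite set \<open>mset_set\<close> would be empty, so reading off its
    members requires finiteness.\<close>
  have "finite {(x, y). x \<in> neighbours G v \<and> y \<in> neighbours G v \<and> x < y}"
    by (rule finite_subset[of _ "neighbours G v \<times> neighbours G v"])
       (auto intro: finite_neighbours[OF assms])
  then show ?thesis
    by (auto simp: star_clique_def)
qed

lemma edge_weighted_graph_star_clique:
  assumes "edge_weighted_graph G" and "simple G"
  shows "edge_weighted_graph (star_clique G v)"
  unfolding edge_weighted_graph_def
proof (intro conjI ballI)
  show "finite (verts (star_clique G v))"
    using assms(1) by (simp add: star_clique_def edge_weighted_graph_def)
next
  fix p assume p: "p \<in># edges (star_clique G v)"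
  obtain e a where ea: "p = (e, a)"
    by fastforce
  consider "(e, a) \<in># edges G" "v \<notin> e"
    | x y where "x \<in> neighbours G v" "y \<in> neighbours G v" "x < y"
        "e = {x, y}" "a = gcd (weight G v x) (weight G v y)"
    using p unfolding ea edges_star_clique_iff[OF assms(1)] by blast
  then have "e \<subseteq> verts (star_clique G v) \<and> card e = 2 \<and> a > 0"
  proof cases
    case 1
    then show ?thesis
      using assms(1) by (auto simp: edge_weighted_graph_def star_clique_def)
  next
    case 2
    then have "weight G v x > 0"
      using edge_weight[OF assms(2)] edge_weighted_graph_edgeD(4)[OF assms(1)] by blast
    then have "a > 0"
      using 2 by simp
    then show ?thesis
      using 2 neighbours_subset[OF assms(1), of v] by (auto simp: star_clique_def)
  qed
  then show "case p of (e, a) \<Rightarrow> e \<subseteq> verts (star_clique G v) \<and> card e = 2 \<and> a > 0"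
    by (simp add: ea)
qed

text \<open>The clique edges encode exactly the solvability of the congruences for a value at
  \<open>v\<close>. Conversely, two neighbours of \<open>v\<close> agree modulo the gcd of their
  weights by passing through \<open>v\<close>.\<close>

lemma splines_star_clique:
  assumes "edge_weighted_graph G" and "simple G" and "v \<in> verts G"
  shows "splines (star_clique G v) = restrict_to (verts G - {v}) ` splines G"
proof (intro equalityI subsetI)
  fix h assume h: "h \<in> splines (star_clique G v)"
  let ?N = "neighbours G v"
  have "[h x = h y] (mod gcd (weight G v x) (weight G v y))" if "x \<in> ?N" "y \<in> ?N" for x y
  proof -
    \<comment> \<open>Clique edges are listed only for \<open>x < y\<close>; the other cases follow
      by symmetry and reflexivity.\<close>
    have less: "[h x = h y] (mod gcd (weight G v x) (weight G v y))"
      if "x \<in> ?N" "y \<in> ?N" "x < y" for x y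
      using h that edges_star_clique_iff[OF assms(1)] unfolding splines_def by blast
    show ?thesis
      using less[of x y] less[of y x] that
      by (cases x y rule: linorder_cases) (auto simp: gcd.commute cong_sym)
  qed
  then obtain z where z: "\<forall>w\<in>?N. [z = h w] (mod weight G v w)"
    using cong_simultaneous_solution[OF finite_neighbours[OF assms(1)], of v h "weight G v"] by blast
  have h0: "h k = 0" if "k \<notin> verts G - {v}" for k
    using h that by (simp add: splines_def star_clique_def)
  have "h(v := z) \<in> splines G"
    unfolding splines_def
  proof (intro CollectI conjI allI impI)
    fix k assume "k \<notin> verts G"
    then show "(h(v := z)) k = 0"
      using assms(3) h0 by auto
  next
    fix k l a assume kl: "({k, l}, a) \<in># edges G"
    have zw: "[z = h w] (mod a)" if "({v, w}, a) \<in># edges G" for w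
      using z that weight_eq[OF assms(2) that] unfolding neighbours_def by blast
    show "[(h(v := z)) k = (h(v := z)) l] (mod a)"
    \<comment> \<open>There are no loops, so at most one of \<open>k\<close> and \<open>l\<close> is
      \<open>v\<close>. An edge avoiding \<open>v\<close> survives in the star-clique.\<close>
    proof (cases "v \<in> {k, l}")
      case True
      then show ?thesis
        using kl zw[of l] zw[of k] edge_weighted_graph_edgeD(1)[OF assms(1) kl]
        by (auto simp: insert_commute cong_sym)
    next
      case False
      then have "({k, l}, a) \<in># edges (star_clique G v)"
        using kl edges_star_clique_iff[OF assms(1)] by blast
      then show ?thesis
        using h False by (auto simp: splines_def)
    qed
  qed
  moreover have "h = restrict_to (verts G - {v}) (h(v := z))"
    using h0 by (auto simp: restrict_to_def)
  ultimately show "h \<in> restrict_to (verts G - {v}) ` splines G"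
    by blast
next
  fix h assume "h \<in> restrict_to (verts G - {v}) ` splines G"
  then obtain g where g: "g \<in> splines G" and h: "h = restrict_to (verts G - {v}) g"
    by blast
  have cong: "[g k = g l] (mod a)" if "({k, l}, a) \<in># edges G" for k l a
    using g that by (auto simp: splines_def)
  show "h \<in> splines (star_clique G v)"
    unfolding splines_def
  proof (intro CollectI conjI allI impI)
    fix k assume "k \<notin> verts (star_clique G v)"
    then show "h k = 0"
      by (auto simp: h restrict_to_def star_clique_def)
  next
    fix k l a assume kl: "({k, l}, a) \<in># edges (star_clique G v)"
    have "k \<in> verts G - {v}" "l \<in> verts G - {v}"
      using edge_weighted_graph_edgeD[OF edge_weighted_graph_star_clique[OF assms(1,2)] kl]
      by (auto simp: star_clique_def)
    then have hg: "h k = g k" "h l = g l"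
      by (simp_all add: h restrict_to_def)
    consider "({k, l}, a) \<in># edges G" "v \<notin> {k, l}"
      | x y where "x \<in> neighbours G v" "y \<in> neighbours G v"
          "{k, l} = {x, y}" "a = gcd (weight G v x) (weight G v y)"
      using kl unfolding edges_star_clique_iff[OF assms(1)] by blast
    then show "[h k = h l] (mod a)"
    proof cases
      case 1
      then show ?thesis
        unfolding hg using cong by blast
    next
      case 2
      have "[g v = g x] (mod a)" "[g v = g y] (mod a)"
        using cong[OF edge_weight[OF assms(2) 2(1)]] cong[OF edge_weight[OF assms(2) 2(2)]]
          2(4) by (auto intro: cong_dvd_modulus)
      then have "[g x = g y] (mod a)"
        by (meson cong_sym cong_trans)
      then show ?thesis
        unfolding hg using 2(3) by (auto simp: doubleton_eq_iff cong_sym)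
    qed
  qed
qed

section \<open>Sequences of collapsing operations\<close>

lemma edge_collapses_splines:
  assumes "edge_collapse\<^sup>*\<^sup>* G H" and "edge_weighted_graph G"
  shows "edge_weighted_graph H \<and> verts H = verts G \<and> splines H = splines G"
  using assms
proof (induction rule: rtranclp_induct)
  case (step H H')
  then show ?case
    using edge_weighted_graph_edge_collapse splines_edge_collapse
    by (metis edge_collapse_def)
qed simp

lemma remove_vertex_splines:
  assumes "remove_vertex G H" and "edge_weighted_graph G"
  shows "edge_weighted_graph H \<and> verts H \<subseteq> verts G \<and>
    splines H = restrict_to (verts H) ` splines G"
proof -
  from assms(1) obtain v where v: "simple G" "v \<in> verts G"
      "edge_collapse\<^sup>*\<^sup>* (star_clique G v) H"
    unfolding remove_vertex_def by blast
  have "verts (star_clique G v) = verts G - {v}"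
    by (simp add: star_clique_def)
  then show ?thesis
    using edge_collapses_splines[OF v(3) edge_weighted_graph_star_clique[OF assms(2) v(1)]]
      splines_star_clique[OF assms(2) v(1,2)] by auto
qed

text \<open>Vertex sets shrink along the sequence, so successive restrictions compose to a single
  one. Being an edge-weighted graph is carried along because each removal requires it.\<close>

lemma collapses_to_splines:
  assumes "collapses_to G H" and "edge_weighted_graph G"
  shows "edge_weighted_graph H \<and> verts H \<subseteq> verts G \<and>
    splines H = restrict_to (verts H) ` splines G"
  using assms(1) unfolding collapses_to_def
proof (induction rule: rtranclp_induct)
  case base
  show ?case
    using assms(2) restrict_to_splines_id by force
next
  case (step H H')
  then have "edge_weighted_graph H' \<and> verts H' \<subseteq> verts H \<and>
      splines H' = restrict_to (verts H') ` splines H"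
    using remove_vertex_splines by blast
  with step.IH show ?case
    by (auto simp: image_image restrict_to_restrict_to)
qed

section \<open>Extensions of modules of integer-valued functions\<close>

lemma z_basis_extension:
  assumes hom: "module_hom zscale zscale f" and M: "zsubspace M"
    and C: "z_basis C (f ` M)" and K: "z_basis K {x \<in> M. f x = 0}"
    and B: "B \<subseteq> M" "bij_betw f B C"
  shows "z_basis (B \<union> K) M"
proof -
  interpret f: module_hom zscale zscale f
    by (rule hom)
  have inj: "inj_on f B" and fB: "f ` B = C"
    using B(2) by (auto simp: bij_betw_def)
  have K0: "f k = 0" "k \<in> M" if "k \<in> K" for k
    using K that by (auto simp: z_basis_def)
  have disj: "B \<inter> K = {}"
  proof (rule ccontr)
    assume "B \<inter> K \<noteq> {}"
    \<comment> \<open>A common element lies in the kernel, so its image 0 would belong to the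
      independent set \<open>C\<close>.\<close>
    then have "0 \<in> C"
      using K0(1) fB by (metis IntE ex_in_conv imageI)
    then show False
      using C zmod.dependent_zero unfolding z_basis_def by blast
  qed
  have "\<not> zdependent (B \<union> K)"
    unfolding zmod.independent_explicit_module
  proof (intro allI impI)
    fix t u v
    assume t: "finite t" "t \<subseteq> B \<union> K" "(\<Sum>v\<in>t. zscale (u v) v) = 0" "v \<in> t"
    define tB tK where "tB = t \<inter> B" and "tK = t \<inter> K"
    have fin: "finite tB" "finite tK" "tB \<inter> tK = {}" "t = tB \<union> tK"
      using t disj by (auto simp: tB_def tK_def)
    have sum: "(\<Sum>v\<in>tB. zscale (u v) v) + (\<Sum>v\<in>tK. zscale (u v) v) = 0"
      using t(3) fin by (simp add: sum.union_disjoint)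
    have injt: "inj_on f tB"
      using inj by (rule inj_on_subset) (simp add: tB_def)
    \<comment> \<open>Applying \<open>f\<close> kills the kernel part. Injectivity on
      \<open>tB\<close> turns the rest into a relation in \<open>C\<close>, with coefficients
      transported by \<open>inv_into\<close>.\<close>
    have "0 = f ((\<Sum>v\<in>tB. zscale (u v) v) + (\<Sum>v\<in>tK. zscale (u v) v))"
      by (simp add: sum)
    also have "\<dots> = (\<Sum>v\<in>tB. zscale (u v) (f v))"
      using K0(1) by (simp add: f.add f.sum f.scale tK_def)
    also have "\<dots> = (\<Sum>w\<in>f ` tB. zscale (u (inv_into tB f w)) w)"
      using injt by (simp add: sum.reindex)
    finally have *: "(\<Sum>w\<in>f ` tB. zscale (u (inv_into tB f w)) w) = 0" ..
    have uB: "u v = 0" if "v \<in> tB" for v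
    proof -
      have "u (inv_into tB f (f v)) = 0"
      proof (rule zmod.independentD[OF _ _ _ *])
        show "\<not> zdependent C"
          using C by (simp add: z_basis_def)
        show "f ` tB \<subseteq> C"
          using fB by (auto simp: tB_def)
      qed (use fin that in auto)
      then show ?thesis
        using injt that by simp
    qed
    then have "(\<Sum>v\<in>tB. zscale (u v) v) = 0"
      by (intro sum.neutral) simp
    with sum have "(\<Sum>v\<in>tK. zscale (u v) v) = 0"
      by simp
    then have "u v = 0" if "v \<in> tK" for v
      using zmod.independentD[of K tK u v] K fin(2) that by (auto simp: z_basis_def tK_def)
    with uB show "u v = 0"
      using t(4) fin(4) by blast
  qed
  moreover have "zspan (B \<union> K) = M"
  proof
    show "zspan (B \<union> K) \<subseteq> M"
      using B(1) K0(2) M by (intro zmod.span_minimal) auto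
    show "M \<subseteq> zspan (B \<union> K)"
    proof
      fix x assume x: "x \<in> M"
      \<comment> \<open>The image of \<open>x\<close> is matched by some \<open>y\<close> in the
        span of \<open>B\<close>; the difference \<open>x - y\<close> then lies in the kernel, which
        \<open>K\<close> spans.\<close>
      then have "f x \<in> f ` zspan B"
        using C fB f.span_image by (auto simp: z_basis_def)
      then obtain y where y: "y \<in> zspan B" "f x = f y"
        by blast
      have "y \<in> M"
        using y(1) B(1) M zmod.span_minimal by blast
      then have "x - y \<in> {x \<in> M. f x = 0}"
        using x y(2) M by (simp add: zmod.subspace_diff f.diff)
      then have "x - y \<in> zspan K"
        using K by (simp add: z_basis_def)
      then have "(x - y) + y \<in> zspan (B \<union> K)"
        using y(1) by (meson zmod.span_add zmod.span_mono subsetD Un_upper1 Un_upper2)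
      then show "x \<in> zspan (B \<union> K)"
        by simp
    qed
  qed
  ultimately show ?thesis
    using B(1) K0(2) by (auto simp: z_basis_def)
qed

text \<open>Linearity is relative to \<open>M\<close>, since a section is constructed only there,
  whereas \<open>module_hom\<close> demands linearity on the whole type.\<close>

definition zlinear_on :: "(nat \<Rightarrow> int) set \<Rightarrow> ((nat \<Rightarrow> int) \<Rightarrow> nat \<Rightarrow> int) \<Rightarrow> bool" where
  "zlinear_on M s \<longleftrightarrow>
     (\<forall>x\<in>M. \<forall>y\<in>M. s (x + y) = s x + s y) \<and> (\<forall>c. \<forall>x\<in>M. s (zscale c x) = zscale c (s x))"

text \<open>The values at \<open>a\<close> form an ideal of the integers; an element attaining the
  least nonzero absolute value generates it. If all values vanish, \<open>b = 0\<close> works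
  because 0 divides 0.\<close>

lemma zsubspace_coordinate_generator:
  assumes "zsubspace M"
  obtains b where "b \<in> M" "\<And>g. g \<in> M \<Longrightarrow> b a dvd g a"
proof (cases "\<exists>g\<in>M. g a \<noteq> 0")
  case False
  then show ?thesis
    using that[of 0] zmod.subspace_0[OF assms] by auto
next
  case True
  let ?P = "\<lambda>g. g \<in> M \<and> g a \<noteq> 0"
  obtain b where b: "?P b" and min: "\<And>g. ?P g \<Longrightarrow> nat \<bar>b a\<bar> \<le> nat \<bar>g a\<bar>"
    using True ex_has_least_nat[of ?P _ "\<lambda>g. nat \<bar>g a\<bar>"] by blast
  show ?thesis
  proof (rule that)
    show "b \<in> M"
      using b by blast
    fix g assume g: "g \<in> M"
    \<comment> \<open>Division with remainder inside \<open>M\<close>: the value of \<open>h\<close>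
      at \<open>a\<close> is the remainder, so minimality forces it to be zero.\<close>
    define h where "h = g - zscale (g a div b a) b"
    have "h \<in> M"
      using g b assms by (simp add: h_def zmod.subspace_diff zmod.subspace_scale)
    moreover have ha: "h a = g a mod b a"
      by (simp add: h_def zscale_def minus_div_mult_eq_mod)
    moreover have "\<bar>g a mod b a\<bar> < \<bar>b a\<bar>"
      using b abs_mod_less by blast
    ultimately have "g a mod b a = 0"
      using min[of h] by fastforce
    then show "b a dvd g a"
      by (simp add: mod_0_imp_dvd)
  qed
qed

text \<open>
  Submodules of \<open>\<int>\<^sup>r\<close> are projective. The section is built one coordinate \<open>a\<close> at a time: the
  values at \<open>a\<close> form a principal ideal, and subtracting a multiple of an element attaining its
  generator leaves an element vanishing at \<open>a\<close>.
\<close>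

lemma zlinear_section_exists:
  assumes hom: "module_hom zscale zscale f" and S: "zsubspace S"
    and "finite A" and "zsubspace M" and "\<And>g k. g \<in> M \<Longrightarrow> k \<notin> A \<Longrightarrow> g k = 0"
    and "M \<subseteq> f ` S"
  shows "\<exists>s. zlinear_on M s \<and> (\<forall>x\<in>M. s x \<in> S \<and> f (s x) = x)"
proof -
  interpret f: module_hom zscale zscale f
    by (rule hom)
  show ?thesis
    using assms(3-6)
  proof (induction A arbitrary: M)
    case empty
    have "M \<subseteq> {0}"
      using empty.prems(2) by fastforce
    then show ?case
      using zmod.subspace_0[OF S] f.zero
      by (intro exI[of _ "\<lambda>x. x"]) (auto simp: zlinear_on_def)
  next
    case (insert a A)
    obtain b where b: "b \<in> M" and dvd: "\<And>g. g \<in> M \<Longrightarrow> b a dvd g a"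
      using zsubspace_coordinate_generator[OF insert.prems(1)] by metis
    obtain c where c: "c \<in> S" "f c = b"
      using b insert.prems(3) by blast
    define M0 where "M0 = {g \<in> M. g a = 0}"
    have "zsubspace M0"
      using insert.prems(1) by (auto simp: M0_def zmod.subspace_def zscale_def)
    moreover have "g k = 0" if "g \<in> M0" "k \<notin> A" for g k
      using that insert.prems(2)[of g k] by (cases "k = a") (auto simp: M0_def)
    moreover have "M0 \<subseteq> f ` S"
      using insert.prems(3) by (auto simp: M0_def)
    ultimately obtain s where s: "zlinear_on M0 s" "\<And>x. x \<in> M0 \<Longrightarrow> s x \<in> S \<and> f (s x) = x"
      using insert.IH by blast
    \<comment> \<open>On \<open>M\<close> this division is exact, hence linear. If
      \<open>b a = 0\<close>, then \<open>q g = 0\<close> and \<open>p g = g\<close>, which already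
      vanishes at \<open>a\<close>.\<close>
    define q where "q g = g a div b a" for g
    define p where "p g = g - zscale (q g) b" for g
    have p: "p g \<in> M0" if "g \<in> M" for g
      using that b insert.prems(1) dvd[OF that]
      by (simp add: M0_def p_def q_def zscale_def zmod.subspace_diff
          zmod.subspace_scale[unfolded zscale_def])
    have q_add: "q (x + y) = q x + q y" if "x \<in> M" "y \<in> M" for x y
      using dvd that by (simp add: q_def div_plus_div_distrib_dvd_left)
    have q_scale: "q (zscale k x) = k * q x" if "x \<in> M" for k x
      using dvd that by (simp add: q_def zscale_def div_mult_swap)
    have p_add: "p (x + y) = p x + p y" if "x \<in> M" "y \<in> M" for x y
      using q_add[OF that] by (simp add: p_def zmod.scale_left_distrib)
    have p_scale: "p (zscale k x) = zscale k (p x)" if "x \<in> M" for k x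
      using q_scale[OF that] by (simp add: p_def zmod.scale_right_diff_distrib)
    \<comment> \<open>Lifts the decomposition of \<open>g\<close> into \<open>p g\<close> and a
      multiple of \<open>b\<close>, with \<open>c\<close> as the lift of \<open>b\<close>.\<close>
    define s' where "s' g = s (p g) + zscale (q g) c" for g
    have "zlinear_on M s'"
      using s(1) p
      by (simp add: zlinear_on_def s'_def p_add p_scale q_add q_scale
          zmod.scale_left_distrib zmod.scale_right_distrib)
    moreover have "s' x \<in> S \<and> f (s' x) = x" if "x \<in> M" for x
      using s(2)[OF p[OF that]] c S
      by (simp add: s'_def f.add f.scale p_def zmod.subspace_add zmod.subspace_scale)
    ultimately show ?case
      by blast
  qed
qed

text \<open>A section splits off the kernel: \<open>x\<close> corresponds to its image together with
  the correction \<open>x - s (f x)\<close>.\<close>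

lemma split_module_iso:
  assumes hom: "module_hom zscale zscale f" and S: "zsubspace S"
    and sec: "zlinear_on (f ` S) s" "\<And>x. x \<in> f ` S \<Longrightarrow> s x \<in> S \<and> f (s x) = x"
  shows "module_iso_on zscale zscale_sum S (f ` S \<times> {x \<in> S. f x = 0})"
proof -
  interpret f: module_hom zscale zscale f
    by (rule hom)
  define h where "h x = (f x, x - s (f x))" for x
  have sf: "s (f x) \<in> S" "f (s (f x)) = f x" if "x \<in> S" for x
    using sec(2) that by auto
  have "bij_betw h S (f ` S \<times> {x \<in> S. f x = 0})"
  proof (rule bij_betw_byWitness[where f' = "\<lambda>(y, k). s y + k"])
    show "h ` S \<subseteq> f ` S \<times> {x \<in> S. f x = 0}"
      using sf S by (auto simp: h_def f.diff zmod.subspace_diff)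
    show "(\<lambda>(y, k). s y + k) ` (f ` S \<times> {x \<in> S. f x = 0}) \<subseteq> S"
      using sf S by (auto intro: zmod.subspace_add)
    show "\<forall>z\<in>f ` S \<times> {x \<in> S. f x = 0}. h ((\<lambda>(y, k). s y + k) z) = z"
      using sf by (auto simp: h_def f.add)
  qed (simp add: h_def)
  moreover have "h (x + y) = h x + h y" if "x \<in> S" "y \<in> S" for x y
    using sec(1) that by (simp add: h_def f.add zlinear_on_def plus_prod_def)
  moreover have "h (zscale c x) = zscale_sum c (h x)" if "x \<in> S" for c x
    using sec(1) that
    by (simp add: h_def f.scale zlinear_on_def zscale_sum_def zmod.scale_right_diff_distrib)
  ultimately show ?thesis
    unfolding module_iso_on_def by blast
qed

section \<open>Flow-up classes under restriction\<close>

lemma module_hom_restr: "module_hom zscale zscale (restr r)"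
  by unfold_locales (auto simp: restr_def zscale_def fun_eq_iff algebra_simps)

lemma restr_eq_restrict_to: "restr r = restrict_to {1..r}"
  by (simp add: restr_def restrict_to_def fun_eq_iff)

text \<open>Since \<open>i < r\<close>, the coordinates up to \<open>Suc i\<close> that decide
  membership all survive restriction.\<close>

lemma restr_in_flow_up_iff:
  assumes "card (verts G) = n" and "card (verts G') = r" and "r \<le> n" and "i < r"
    and "splines G' = restr r ` splines G" and "F \<in> splines G"
  shows "restr r F \<in> flow_up G' i \<longleftrightarrow> F \<in> flow_up G i"
  using assms by (auto simp: flow_up_def restr_def)

theorem theorem4p1:
  fixes G G' :: wgraph and n r :: nat
  assumes "edge_weighted_graph G" and "simple G" and "verts G = {1..n}"
    and "collapses_to G G'" and "verts G' = {1..r}"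
    and "1 \<le> r" and "r \<le> n"
  defines "\<phi> \<equiv> restr r" and "K \<equiv> ker_restr G r"
  shows
    "(\<forall>i<r. \<phi> ` flow_up G i = flow_up G' i) \<and>
     (\<forall>i<r. \<forall>F\<in>flow_up G i. leading_term G F = leading_term G' (\<phi> F)) \<and>
     (\<forall>i<r. \<forall>F\<in>flow_up G i. minimal_element G i F \<longleftrightarrow> minimal_element G' i (\<phi> F)) \<and>
     (\<forall>B' \<K> B.
        flow_up_class_basis G' {0..<r} (splines G') B' \<and>
        flow_up_class_basis G {r..<n} K \<K> \<and>
        B \<subseteq> splines G \<and> bij_betw \<phi> B B' \<longrightarrow>
        flow_up_class_basis G {0..<n} (splines G) (B \<union> \<K>)) \<and>
     module_iso_on zscale zscale_sum (splines G) (splines G' \<times> K)"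
proof -
  have G': "splines G' = \<phi> ` splines G"
    using collapses_to_splines[OF assms(4,1)] assms(5) by (simp add: \<phi>_def restr_eq_restrict_to)
  have K: "K = {x \<in> splines G. \<phi> x = 0}"
    by (simp add: K_def \<phi>_def ker_restr_def)
  have hom: "module_hom zscale zscale \<phi>"
    unfolding \<phi>_def by (rule module_hom_restr)
  have flow_up_splines: "flow_up H i \<subseteq> splines H" if "i < card (verts H)" for H i
    using that by (auto simp: flow_up_def)
  have flow_iff: "\<phi> F \<in> flow_up G' i \<longleftrightarrow> F \<in> flow_up G i" if "F \<in> splines G" "i < r" for F i
    unfolding \<phi>_def
    by (rule restr_in_flow_up_iff[where n = n]) (use assms that G' in auto)
  have 1: "\<phi> ` flow_up G i = flow_up G' i" if "i < r" for i
  proof -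
    have "flow_up G i \<subseteq> splines G" "flow_up G' i \<subseteq> \<phi> ` splines G"
      using flow_up_splines[of i G] flow_up_splines[of i G'] that assms(3,5,7)
      by (auto simp: G')
    then show ?thesis
      \<comment> \<open>An element of \<open>flow_up G' i\<close> has some spline on
        \<open>G\<close> as a preimage, and \<open>flow_iff\<close> places that preimage in
        \<open>flow_up G i\<close>.\<close>
      using flow_iff that by blast
  qed
  have 2: "leading_term G F = leading_term G' (\<phi> F)" if "i < r" "F \<in> flow_up G i" for i F
  proof -
    have "\<phi> F \<in> flow_up G' i"
      using 1[OF that(1)] that(2) by blast
    then show ?thesis
      using that by (simp add: leading_term_eq[of _ G' i] leading_term_eq[of _ G i] \<phi>_def restr_def)
  qed
  have 3: "minimal_element G i F \<longleftrightarrow> minimal_element G' i (\<phi> F)"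
    if "i < r" "F \<in> flow_up G i" for i F
    \<comment> \<open>By (1) the competitors in \<open>flow_up G' i\<close> are the images of those
      in \<open>flow_up G i\<close>, and by (2) their leading terms agree.\<close>
    unfolding minimal_element_def using 2[OF that(1)] that(2) by (auto simp flip: 1[OF that(1)])
  have 4: "flow_up_class_basis G {0..<n} (splines G) (B \<union> \<K>)"
    if B': "flow_up_class_basis G' {0..<r} (splines G') B'"
      and \<K>: "flow_up_class_basis G {r..<n} K \<K>"
      and B: "B \<subseteq> splines G" "bij_betw \<phi> B B'" for B' \<K> B
  proof -
    obtain b' where b': "\<And>i. i < r \<Longrightarrow> minimal_element G' i (b' i)" "B' = b' ` {0..<r}"
      using B' unfolding flow_up_class_basis_def by (metis atLeastLessThan_iff le0)
    obtain k where k: "\<And>i. i \<in> {r..<n} \<Longrightarrow> minimal_element G i (k i)" "\<K> = k ` {r..<n}"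
      using \<K> unfolding flow_up_class_basis_def by metis
    \<comment> \<open>Below \<open>r\<close> the chosen preimage in \<open>B\<close> is minimal by
      (3); from \<open>r\<close> on the kernel basis supplies the minimal elements.\<close>
    define b where "b i = (if i < r then inv_into B \<phi> (b' i) else k i)" for i
    have "minimal_element G i (b i)" if "i \<in> {0..<n}" for i
    proof (cases "i < r")
      case True
      then have "b' i \<in> \<phi> ` B"
        using b'(2) B(2) by (auto simp: bij_betw_def)
      then have bi: "b i \<in> B" "\<phi> (b i) = b' i"
        using True by (auto simp: b_def inv_into_into f_inv_into_f)
      then have "b i \<in> flow_up G i"
        using flow_iff[of "b i" i] True b'(1)[OF True] B(1) by (auto simp: minimal_element_def)
      then show ?thesis
        using 3[OF True] bi(2) b'(1)[OF True] by simp
    next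
      case False
      then show ?thesis
        using that k(1) by (simp add: b_def)
    qed
    moreover have "b ` {0..<n} = B \<union> \<K>"
    proof -
      have "{0..<n} = {0..<r} \<union> {r..<n}"
        using assms(7) by auto
      moreover have "b ` {0..<r} = inv_into B \<phi> ` B'"
        unfolding b'(2) image_image by (intro image_cong) (auto simp: b_def)
      moreover have "inv_into B \<phi> ` B' = B"
        using bij_betw_inv_into[OF B(2)] by (simp add: bij_betw_def)
      moreover have "b ` {r..<n} = \<K>"
        unfolding k(2) by (intro image_cong) (auto simp: b_def)
      ultimately show ?thesis
        by (simp add: image_Un)
    qed
    moreover have "z_basis (B \<union> \<K>) (splines G)"
      using B' \<K> B unfolding flow_up_class_basis_def G' K
      by (intro z_basis_extension[OF hom zsubspace_splines, of B']) auto
    ultimately show ?thesis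
      unfolding flow_up_class_basis_def by blast
  qed
  have "g k = 0" if "g \<in> splines G'" "k \<notin> {1..r}" for g k
    using that assms(5) by (auto simp: splines_def)
  moreover have "splines G' \<subseteq> \<phi> ` splines G"
    by (simp add: G')
  \<comment> \<open>Splines on \<open>G'\<close> are supported on the finite set of coordinates from
    1 to \<open>r\<close>, so a linear section exists.\<close>
  ultimately have "\<exists>s. zlinear_on (splines G') s \<and>
      (\<forall>x\<in>splines G'. s x \<in> splines G \<and> \<phi> (s x) = x)"
    by (intro zlinear_section_exists[OF hom zsubspace_splines _ zsubspace_splines, of "{1..r}"])
      auto
  then obtain s where "zlinear_on (splines G') s"
      "\<And>x. x \<in> splines G' \<Longrightarrow> s x \<in> splines G \<and> \<phi> (s x) = x"
    by blast
  then have 5: "module_iso_on zscale zscale_sum (splines G) (splines G' \<times> K)"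
    unfolding G' K using split_module_iso[OF hom zsubspace_splines] by blast
  show ?thesis
    by (intro conjI allI impI ballI) (simp_all add: 1 2 3 5, elim conjE, rule 4, assumption+)
qed

end
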